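(* If $p\in\beta N$ and $P\in p$, then $p$ is irreducible in $\beta N$.
   Context: $N=\{1,2,3,\dots\}$, $P=\{n\in N:n\text{ is prime}\}$, and $\beta N$ is the set of all ultrafilters on $N$; each $n\in N$ is identified with the principal ultrafilter $\{A\subseteq N:n\in A\}$. For $A\subseteq N$ and $n\in N$, $A/n=\{m\in N:mn\in A\}$. Multiplication on $\beta N$ (extending that of $N$) is defined by: $A\in p\cdot q$ if and only if $\{n\in N:A/n\in q\}\in p$. An element $p\in\beta N$ is irreducible in $X\subseteq\beta N$ if it cannot be represented in the form $p=xy$ for $x,y\in X\setminus\{1\}$. *)

theory Defs
  imports "HOL-Computational_Algebra.Primes"
begin

(* N = {1, 2, 3, ...} is a proper subset of the type nat, so every family of sets
   below is kept inside Pow Npos and complements are taken relative to Npos. *)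
definition Npos :: "nat set" where
  "Npos = {n. 1 \<le> n}"

definition ultrafilter_on :: "'a set \<Rightarrow> 'a set set \<Rightarrow> bool" where
  "ultrafilter_on S p \<longleftrightarrow>
     p \<subseteq> Pow S \<and> S \<in> p \<and> {} \<notin> p \<and>
     (\<forall>A\<in>p. \<forall>B\<in>p. A \<inter> B \<in> p) \<and>
     (\<forall>A\<in>p. \<forall>B. A \<subseteq> B \<and> B \<subseteq> S \<longrightarrow> B \<in> p) \<and>
     (\<forall>A. A \<subseteq> S \<longrightarrow> A \<in> p \<or> S - A \<in> p)"

definition betaN :: "nat set set set" where
  "betaN = {p. ultrafilter_on Npos p}"

definition principal_uf :: "nat \<Rightarrow> nat set set" where
  "principal_uf n = {A. A \<subseteq> Npos \<and> n \<in> A}"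

definition quot :: "nat set \<Rightarrow> nat \<Rightarrow> nat set" where
  "quot A n = {m \<in> Npos. m * n \<in> A}"

definition beta_mult :: "nat set set \<Rightarrow> nat set set \<Rightarrow> nat set set" where
  "beta_mult p q = {A. A \<subseteq> Npos \<and> {n \<in> Npos. quot A n \<in> q} \<in> p}"

(* The excluded element 1 is the principal ultrafilter at 1, and p itself need not
   belong to X. *)
definition irreducible_in :: "nat set set set \<Rightarrow> nat set set \<Rightarrow> bool" where
  "irreducible_in X p \<longleftrightarrow>
     \<not> (\<exists>x \<in> X - {principal_uf 1}. \<exists>y \<in> X - {principal_uf 1}. p = beta_mult x y)"

definition Primes :: "nat set" where
  "Primes = {n \<in> Npos. prime n}"

lemma principal_uf_in_betaN: "n \<in> Npos \<Longrightarrow> principal_uf n \<in> betaN"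
  by (auto simp: betaN_def ultrafilter_on_def principal_uf_def)

lemma beta_mult_principal_uf:
  assumes "m \<in> Npos" "n \<in> Npos"
  shows "beta_mult (principal_uf m) (principal_uf n) = principal_uf (m * n)"
  using assms by (auto simp: beta_mult_def principal_uf_def quot_def mult.commute)

lemma beta_mult_in_betaN:
  assumes "p \<in> betaN" "q \<in> betaN"
  shows "beta_mult p q \<in> betaN"
proof -
  define D where "D A = {n \<in> Npos. quot A n \<in> q}" for A
  have p: "ultrafilter_on Npos p" and q: "ultrafilter_on Npos q"
    using assms by (simp_all add: betaN_def)
  have uf_int: "A \<inter> B \<in> r" if "ultrafilter_on Npos r" "A \<in> r" "B \<in> r" for A B r
    using that unfolding ultrafilter_on_def by simp
  have uf_up: "B \<in> r" if "ultrafilter_on Npos r" "A \<in> r" "A \<subseteq> B" "B \<subseteq> Npos" for A B r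
    using that unfolding ultrafilter_on_def by simp
  have uf_compl: "A \<in> r \<or> Npos - A \<in> r" if "ultrafilter_on Npos r" "A \<subseteq> Npos" for A r
    using that unfolding ultrafilter_on_def by simp
  have uf_top: "Npos \<in> r" and uf_bot: "{} \<notin> r" if "ultrafilter_on Npos r" for r
    using that unfolding ultrafilter_on_def by simp_all
  have quot_sub: "quot A n \<subseteq> Npos" for A n
    by (auto simp: quot_def)
  have D_sub: "D A \<subseteq> Npos" for A
    by (auto simp: D_def)
  have quot_top: "quot Npos n = Npos" if "n \<in> Npos" for n
    using that by (auto simp: quot_def Npos_def)
  have top: "D Npos = Npos"
    using uf_top[OF q] by (auto simp: D_def quot_top)
  have bot: "D {} = {}"
    using uf_bot[OF q] by (simp add: D_def quot_def)
  have D_int: "D A \<inter> D B \<subseteq> D (A \<inter> B)" for A B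
  proof -
    have "quot (A \<inter> B) n = quot A n \<inter> quot B n" for n
      by (auto simp: quot_def)
    then show ?thesis
      by (auto simp: D_def intro: uf_int[OF q])
  qed
  have D_mono: "D A \<subseteq> D B" if "A \<subseteq> B" for A B
  proof -
    have "quot A n \<subseteq> quot B n" for n
      using that by (auto simp: quot_def)
    then show ?thesis
      unfolding D_def using uf_up[OF q _ _ quot_sub] by blast
  qed
  have D_compl: "Npos - D A \<subseteq> D (Npos - A)" for A
  proof
    fix n assume n: "n \<in> Npos - D A"
    then have "Npos - quot A n = quot (Npos - A) n"
      by (auto simp: quot_def Npos_def)
    moreover have "quot A n \<notin> q"
      using n by (simp add: D_def)
    ultimately show "n \<in> D (Npos - A)"
      using n uf_compl[OF q quot_sub[of A n]] by (simp add: D_def)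
  qed
  have mult: "beta_mult p q = {A. A \<subseteq> Npos \<and> D A \<in> p}"
    by (simp add: beta_mult_def D_def)
  have 1: "D (A \<inter> B) \<in> p" if "D A \<in> p" "D B \<in> p" for A B
    by (rule uf_up[OF p uf_int[OF p that] D_int D_sub])
  have 2: "D B \<in> p" if "D A \<in> p" "A \<subseteq> B" for A B
    by (rule uf_up[OF p that(1) D_mono[OF that(2)] D_sub])
  have 3: "D A \<in> p \<or> D (Npos - A) \<in> p" for A
    using uf_compl[OF p D_sub[of A]] uf_up[OF p _ D_compl D_sub] by metis
  have "ultrafilter_on Npos (beta_mult p q)"
    unfolding ultrafilter_on_def mult
  proof (intro conjI)
    show "Npos \<in> {A. A \<subseteq> Npos \<and> D A \<in> p}"
      using uf_top[OF p] by (simp add: top)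
    show "{} \<notin> {A. A \<subseteq> Npos \<and> D A \<in> p}"
      using uf_bot[OF p] by (simp add: bot)
    show "\<forall>A. A \<subseteq> Npos \<longrightarrow>
        A \<in> {A. A \<subseteq> Npos \<and> D A \<in> p} \<or> Npos - A \<in> {A. A \<subseteq> Npos \<and> D A \<in> p}"
      using 3 by simp
  qed (use 1 2 in blast)+
  then show ?thesis
    by (simp add: betaN_def)
qed

end

theory Submission
  imports Defs
begin

text \<open>
  For \<open>n > 1\<close> the product \<open>m * n\<close> is prime only if \<open>m = 1\<close>, so the quotient of the primes by
  any such \<open>n\<close> is contained in \<open>{1}\<close>. Suppose \<open>p = x \<cdot> y\<close> contains the primes. Then \<open>x\<close>-almost all
  \<open>n\<close> have a quotient lying in \<open>y\<close>. If \<open>x \<noteq> 1\<close>, an \<open>x\<close>-large set cannot be contained in \<open>{1}\<close>, so some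
  \<open>n > 1\<close> has this property; hence \<open>{1} \<in> y\<close>, that is, \<open>y = 1\<close>. Both halves of the argument use
  \<open>ultrafilter_eq_principal_ufI\<close>: an ultrafilter with a member inside \<open>{k}\<close> is principal at \<open>k\<close>.
\<close>

text \<open>
  Every member meets \<open>A \<subseteq> {k}\<close>, and so contains \<open>k\<close>; conversely, a set containing \<open>k\<close>
  is a superset of \<open>A\<close>.
\<close>
lemma ultrafilter_eq_principal_ufI:
  assumes "q \<in> betaN" and "A \<in> q" and "A \<subseteq> {k}"
  shows "q = principal_uf k"
proof -
  have q: "ultrafilter_on Npos q"
    using assms(1) by (simp add: betaN_def)
  have int: "B \<inter> C \<in> q" if "B \<in> q" "C \<in> q" for B C
    using q that unfolding ultrafilter_on_def by simp
  have up: "C \<in> q" if "B \<in> q" "B \<subseteq> C" "C \<subseteq> Npos" for B C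
    using q that unfolding ultrafilter_on_def by simp
  have sub: "q \<subseteq> Pow Npos" and bot: "{} \<notin> q"
    using q unfolding ultrafilter_on_def by simp_all
  show ?thesis
  proof (rule set_eqI)
    fix B
    show "B \<in> q \<longleftrightarrow> B \<in> principal_uf k"
    proof
      assume B: "B \<in> q"
      then have "A \<inter> B \<noteq> {}"
        using int[OF assms(2) B] bot by metis
      then have "k \<in> B"
        using assms(3) by blast
      then show "B \<in> principal_uf k"
        using B sub by (auto simp: principal_uf_def)
    next
      assume "B \<in> principal_uf k"
      then have "A \<subseteq> B" "B \<subseteq> Npos"
        using assms(3) by (auto simp: principal_uf_def)
      then show "B \<in> q"
        by (rule up[OF assms(2)])
    qed
  qed
qed

lemma quot_Primes_subset:
  assumes "n \<noteq> 1"
  shows "quot Primes n \<subseteq> {1}"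
  using assms by (auto simp: quot_def Primes_def dest: prime_product)

theorem lemma7p3:
  fixes p :: "nat set set"
  assumes "p \<in> betaN" and "Primes \<in> p"
  shows "irreducible_in betaN p"
  unfolding irreducible_in_def
proof
  assume "\<exists>x \<in> betaN - {principal_uf 1}. \<exists>y \<in> betaN - {principal_uf 1}. p = beta_mult x y"
  then obtain x y where x: "x \<in> betaN" "x \<noteq> principal_uf 1"
    and y: "y \<in> betaN" "y \<noteq> principal_uf 1" and p: "p = beta_mult x y"
    by blast
  have large: "{n \<in> Npos. quot Primes n \<in> y} \<in> x"
    using assms(2) p by (simp add: beta_mult_def)
  have "\<not> {n \<in> Npos. quot Primes n \<in> y} \<subseteq> {1}"
    using ultrafilter_eq_principal_ufI[OF x(1) large] x(2) by blast
  then obtain n where "n \<noteq> 1" and n: "quot Primes n \<in> y"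
    by blast
  then have "y = principal_uf 1"
    using ultrafilter_eq_principal_ufI[OF y(1) n quot_Primes_subset] by blast
  with y(2) show False ..
qed

end
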